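(* Let $G$ be an outerplanar map. Then the faces of $G$ can be non-repetitively coloured using at most five colours.
   Context: A finite sequence $a_1a_2\cdots a_n$ is called non-repetitive if it contains no two identical adjacent blocks, i.e. there are no $i$ and $m\ge 1$ with $i+2m-1\le n$ and $a_{i+j}=a_{i+m+j}$ for all $0\le j<m$. An outerplanar map is a plane graph embedded so that all vertices lie on the boundary of the outer face. A colouring of the faces of a planar map (including the outer face) is called non-repetitive if for every sequence $F_1,\dots,F_n$ of pairwise distinct faces such that $F_i$ and $F_{i+1}$ share an edge for each $i$, the sequence of colours of $F_1,\dots,F_n$ is non-repetitive. *)

theory Defs
  imports "HOL-Analysis.Analysis"
begin

definition plane_graph :: "complex set \<Rightarrow> (real \<Rightarrow> complex) set \<Rightarrow> bool" where
  "plane_graph V E \<longleftrightarrow>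
     finite V \<and> finite E \<and>
     (\<forall>e\<in>E. arc e \<and> pathstart e \<in> V \<and> pathfinish e \<in> V) \<and>
     (\<forall>e\<in>E. \<forall>v\<in>V. v \<in> path_image e \<longrightarrow> v = pathstart e \<or> v = pathfinish e) \<and>
     (\<forall>e\<in>E. \<forall>e'\<in>E. e \<noteq> e' \<longrightarrow>
        path_image e \<inter> path_image e' \<subseteq> {pathstart e, pathfinish e} \<and>
        {pathstart e, pathfinish e} \<noteq> {pathstart e', pathfinish e'})"

definition drawing :: "complex set \<Rightarrow> (real \<Rightarrow> complex) set \<Rightarrow> complex set" where
  "drawing V E = V \<union> \<Union> (path_image ` E)"

definition faces :: "complex set \<Rightarrow> (real \<Rightarrow> complex) set \<Rightarrow> complex set set" where
  "faces V E = components (- drawing V E)"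

definition outerplanar_map :: "complex set \<Rightarrow> (real \<Rightarrow> complex) set \<Rightarrow> bool" where
  "outerplanar_map V E \<longleftrightarrow> plane_graph V E \<and>
     (\<forall>v\<in>V. \<exists>F\<in>faces V E. \<not> bounded F \<and> v \<in> frontier F)"

definition faces_share_edge ::
  "(real \<Rightarrow> complex) set \<Rightarrow> complex set \<Rightarrow> complex set \<Rightarrow> bool" where
  "faces_share_edge E F F' \<longleftrightarrow>
     (\<exists>e\<in>E. path_image e \<subseteq> frontier F \<and> path_image e \<subseteq> frontier F')"

definition nonrepetitive :: "'a list \<Rightarrow> bool" where
  "nonrepetitive xs \<longleftrightarrow>
     \<not> (\<exists>i m. m \<ge> 1 \<and> i + 2 * m \<le> length xs \<and>
            (\<forall>j<m. xs ! (i + j) = xs ! (i + m + j)))"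

definition nonrep_face_colouring ::
  "complex set \<Rightarrow> (real \<Rightarrow> complex) set \<Rightarrow> (complex set \<Rightarrow> 'c) \<Rightarrow> bool" where
  "nonrep_face_colouring V E c \<longleftrightarrow>
     (\<forall>Fs. set Fs \<subseteq> faces V E \<and> distinct Fs \<and>
           (\<forall>i. Suc i < length Fs \<longrightarrow> faces_share_edge E (Fs ! i) (Fs ! Suc i))
           \<longrightarrow> nonrepetitive (map c Fs))"

end

theory Submission
  imports Defs
begin

text \<open>The outer face gets a colour of its own, so that no repetition can involve it, and it remains to
  colour the bounded faces with four colours. Any two adjacent bounded faces are separated by the
  union of their common edge with the closure of the outer face, which contains both ends of that
  edge. Hence the edge is a bridge of the adjacency graph of the bounded faces, and this graph is a
  forest. All separation arguments rest on Janiszewski's theorem; no local analysis of the drawing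
  is needed. The vertices of a forest are coloured by their level, read off a
  square-free word over four letters without nontrivial palindromes.\<close>

section \<open>A square-free word without palindromes\<close>

fun thue_morse :: "nat \<Rightarrow> bool" where
  "thue_morse n = (if n = 0 then False else thue_morse (n div 2) \<noteq> odd n)"

declare thue_morse.simps [simp del]

lemma thue_morse_double: "thue_morse (2 * n) = thue_morse n"
  by (cases "n = 0") (simp_all add: thue_morse.simps[of "2 * n"])

lemma thue_morse_double_Suc: "thue_morse (Suc (2 * n)) \<longleftrightarrow> \<not> thue_morse n"
  by (simp add: thue_morse.simps[of "Suc (2 * n)"])

lemma thue_morse_even_step: "even n \<Longrightarrow> thue_morse (Suc n) \<longleftrightarrow> \<not> thue_morse n"
  by (elim evenE) (simp add: thue_morse_double thue_morse_double_Suc)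

text \<open>An even period is halved by reading every second letter from \<open>i\<close> on. For an
  odd period, one of \<open>i + j\<close> and \<open>i + m + j\<close> is even, so the letter flips
  after it; hence the letters alternate and those at \<open>i\<close> and \<open>i + m\<close>
  differ.\<close>

lemma thue_morse_overlap_free:
  assumes "m \<ge> 1" "\<forall>j\<le>m. thue_morse (i + j) = thue_morse (i + m + j)"
  shows False
  using assms
proof (induction m arbitrary: i rule: less_induct)
  case (less m)
  note eq = less.prems(2)
  show False
  proof (cases "even m")
    case True
    then obtain k where k: "m = 2 * k" by (elim evenE)
    obtain a where a: "i = 2 * a \<or> i = Suc (2 * a)"
      by (metis evenE oddE Suc_eq_plus1)
    have "thue_morse (a + b) = thue_morse (a + k + b)" if "b \<le> k" for b
    proof -
      have "2 * b \<le> m" using that k by simp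
      with eq have e: "thue_morse (i + 2 * b) = thue_morse (i + m + 2 * b)" by blast
      from a show ?thesis
      proof
        assume "i = 2 * a"
        then have "i + 2 * b = 2 * (a + b)" "i + m + 2 * b = 2 * (a + k + b)" using k by auto
        then show ?thesis using e by (simp only: thue_morse_double)
      next
        assume "i = Suc (2 * a)"
        then have "i + 2 * b = Suc (2 * (a + b))" "i + m + 2 * b = Suc (2 * (a + k + b))"
          using k by auto
        then show ?thesis using e by (simp only: thue_morse_double_Suc) blast
      qed
    qed
    moreover have "k < m" "k \<ge> 1" using k less.prems(1) by auto
    ultimately show False using less.IH[of k a] by blast
  next
    case False
    have alt: "thue_morse (Suc (i + j)) \<longleftrightarrow> \<not> thue_morse (i + j)" if "j < m" for j
    proof (cases "even (i + j)")
      case False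
      with \<open>odd m\<close> have "even (i + m + j)" by auto
      from thue_morse_even_step[OF this] eq[rule_format, of j] eq[rule_format, of "Suc j"] that
      show ?thesis by simp
    qed (rule thue_morse_even_step)
    have "j \<le> m \<Longrightarrow> thue_morse (i + j) \<longleftrightarrow> (thue_morse i \<noteq> odd j)" for j
      by (induction j) (auto simp: alt)
    from this[of m] eq[rule_format, of 0] \<open>odd m\<close> show False by simp
  qed
qed

text \<open>The difference of consecutive Thue-Morse letters, shifted by one to be a natural number;
  the addition comes first, so the subtraction never truncates.\<close>

definition ternary_thue :: "nat \<Rightarrow> nat" where
  "ternary_thue n = 1 + of_bool (thue_morse (Suc n)) - of_bool (thue_morse n)"

lemma ternary_thue_less: "ternary_thue n < 3"
  by (simp add: ternary_thue_def)

text \<open>Sums of differences telescope, so a square gives two equal changes in succession, from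
  \<open>i\<close> to \<open>i + m\<close> and from there to \<open>i + m + m\<close>. For values 0
  and 1 both must vanish, which leaves an overlap.\<close>

lemma ternary_thue_square_free:
  assumes "m \<ge> 1" "\<forall>j<m. ternary_thue (i + j) = ternary_thue (i + m + j)"
  shows False
proof -
  define t where "t n = (of_bool (thue_morse n) :: int)" for n
  have v: "int (ternary_thue n) = 1 + t (Suc n) - t n" for n
    by (simp add: ternary_thue_def t_def)
  have tele: "j \<le> m \<Longrightarrow> t (i + j) - t i = t (i + m + j) - t (i + m)" for j
  proof (induction j)
    case (Suc j)
    then have "int (ternary_thue (i + j)) = int (ternary_thue (i + m + j))"
      using assms(2) by auto
    with Suc show ?case by (simp add: v)
  qed simp
  have "t (i + m) = t i"
    using tele[of m] by (auto simp: t_def of_bool_def split: if_splits)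
  then have "t (i + j) = t (i + m + j)" if "j \<le> m" for j
    using tele[OF that] by simp
  then have "\<forall>j\<le>m. thue_morse (i + j) = thue_morse (i + m + j)"
    unfolding t_def by (metis of_bool_eq_iff)
  with thue_morse_overlap_free[OF assms(1)] show False .
qed

text \<open>Inserting a fourth letter after every second letter of a square-free word over three letters
  destroys all palindromes of length at least two while keeping square-freeness.\<close>

definition level_word :: "nat \<Rightarrow> nat" where
  "level_word n = (if n mod 3 = 2 then 3 else ternary_thue (2 * (n div 3) + n mod 3))"

lemma level_word_less: "level_word n < 4"
  using ternary_thue_less[of "2 * (n div 3) + n mod 3"] by (simp add: level_word_def)

lemma level_word_eq_3_iff: "level_word n = 3 \<longleftrightarrow> n mod 3 = 2"
  using ternary_thue_less[of "2 * (n div 3) + n mod 3"] by (auto simp: level_word_def)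

lemma level_word_ternary: "level_word (3 * (a div 2) + a mod 2) = ternary_thue a"
proof -
  have "a mod 2 < 2" by simp
  then have "a mod 2 < 3" "a mod 2 \<noteq> 2" by linarith+
  moreover from this have "(3 * (a div 2) + a mod 2) mod 3 = a mod 2"
    "(3 * (a div 2) + a mod 2) div 3 = a div 2"
    by (metis mod_mult_self4 mod_less, metis div_mult_self4 div_less add_0_right zero_neq_numeral)
  moreover have "2 * (a div 2) + a mod 2 = a" by simp
  ultimately show ?thesis by (simp only: level_word_def if_False)
qed

lemma ternary_thue_neq_Suc: "ternary_thue n \<noteq> ternary_thue (Suc n)"
  using ternary_thue_square_free[of 1 n] by auto

text \<open>Of two positions at distance one or two, either exactly one carries an inserted 3, or
  they carry consecutive ternary letters. The centre of any longer palindrome is such a pair of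
  equal letters.\<close>

lemma level_word_no_palindrome:
  shows level_word_neq_1: "level_word n \<noteq> level_word (Suc n)"
    and level_word_neq_2: "level_word n \<noteq> level_word (n + 2)"
proof -
  define q where "q = n div 3"
  have n: "n = 3 * q \<or> n = 3 * q + 1 \<or> n = 3 * q + 2" unfolding q_def by linarith
  have w: "level_word (3 * k) = ternary_thue (2 * k)"
    "level_word (3 * k + 1) = ternary_thue (Suc (2 * k))" "level_word (3 * k + 2) = 3" for k
    using level_word_ternary[of "2 * k"] level_word_ternary[of "Suc (2 * k)"]
    by (simp_all add: level_word_eq_3_iff mod_Suc)
  have lt: "ternary_thue k \<noteq> 3" "3 \<noteq> ternary_thue k" for k
    using ternary_thue_less[of k] by simp_all
  have s: "Suc (3 * q) = 3 * q + 1" "Suc (3 * q + 1) = 3 * q + 2" "Suc (3 * q + 2) = 3 * (q + 1)"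
    "3 * q + 1 + 2 = 3 * (q + 1)" "3 * q + 2 + 2 = 3 * (q + 1) + 1" by simp_all
  note v = ternary_thue_neq_Suc[of "2 * q"] ternary_thue_neq_Suc[of "Suc (2 * q)"]
  have v': "Suc (Suc (2 * q)) = 2 * (q + 1)" by simp
  from n show "level_word n \<noteq> level_word (Suc n)"
    by (elim disjE) (simp_all only: s w lt v not_False_eq_True)
  from n show "level_word n \<noteq> level_word (n + 2)"
    by (elim disjE) (simp_all only: s w lt v[unfolded v'] not_False_eq_True)
qed

text \<open>The inserted 3s fill one residue class modulo 3, so a period of at least three is
  divisible by 3, and deleting the 3s leaves a ternary square. Shorter periods are excluded by the
  absence of palindromes.\<close>

lemma level_word_square_free:
  assumes "m \<ge> 1" "\<forall>j<m. level_word (i + j) = level_word (i + m + j)"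
  shows False
proof (cases "m < 3")
  case True
  with assms(1) have "m = 1 \<or> m = 2" by auto
  then show False
    using assms(2)[rule_format, of 0] level_word_neq_1[of i] level_word_neq_2[of i] by auto
next
  case False
  have "i mod 3 = 0 \<or> i mod 3 = 1 \<or> i mod 3 = 2" by linarith
  then have "\<exists>j<3. (i + j) mod 3 = 2"
    by (elim disjE) (rule exI[of _ 2], simp add: mod_Suc, rule exI[of _ 1], simp add: mod_Suc,
      rule exI[of _ 0], simp)
  with False obtain j where j: "j < m" "(i + j) mod 3 = 2"
    by (meson less_le_trans not_less)
  then have "(i + m + j) mod 3 = 2"
    using assms(2) level_word_eq_3_iff by metis
  with j(2) have "m mod 3 = 0" by presburger
  then obtain k where k: "m = 3 * k" by auto
  \<comment> \<open>The number of ternary letters before position \<open>i\<close>, hence the index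
    of the first one at or after \<open>i\<close>.\<close>
  define a where "a = 2 * (i div 3) + i mod 3"
  have "ternary_thue (a + b) = ternary_thue (a + 2 * k + b)" if b: "b < 2 * k" for b
  proof -
    define p where "p = 3 * ((a + b) div 2) + (a + b) mod 2"
    have p: "i \<le> p" "p < i + m"
    proof -
      define q r x y where "q = i div 3" and "r = i mod 3"
        and "x = (a + b) div 2" and "y = (a + b) mod 2"
      have "i = 3 * q + r" "a + b = 2 * x + y" "r = 0 \<or> r = 1 \<or> r = 2" "y = 0 \<or> y = 1"
        unfolding q_def r_def x_def y_def by (simp, simp, linarith, linarith)
      moreover have "a = 2 * q + r" "p = 3 * x + y"
        unfolding a_def q_def r_def p_def x_def y_def by simp_all
      ultimately show "i \<le> p" "p < i + m" using b k by (elim disjE; linarith)+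
    qed
    have "(a + 2 * k + b) div 2 = (a + b) div 2 + k" "(a + 2 * k + b) mod 2 = (a + b) mod 2"
      by presburger+
    then have "3 * ((a + 2 * k + b) div 2) + (a + 2 * k + b) mod 2 = p + m"
      unfolding p_def k by simp
    then have "level_word (p + m) = ternary_thue (a + 2 * k + b)"
      using level_word_ternary by metis
    moreover have "level_word p = ternary_thue (a + b)"
      unfolding p_def by (rule level_word_ternary)
    moreover have "level_word p = level_word (p + m)"
      using assms(2)[rule_format, of "p - i"] p by (simp add: algebra_simps)
    ultimately show ?thesis by simp
  qed
  moreover have "2 * k \<ge> 1" using k assms(1) by auto
  ultimately show False using ternary_thue_square_free[of "2 * k" a] by blast
qed

text \<open>With the bottom \<open>t\<close> at either end, a stretch of the word is read forwards
  or backwards and a repetition is a square. With the bottom strictly inside one half, its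
  neighbours have equal levels but their counterparts differ by two. With the bottom at the
  junction, some two corresponding levels differ by one or two.\<close>

lemma level_word_valley:
  fixes l :: "nat \<Rightarrow> nat"
  assumes "m \<ge> 1" "t < 2 * m"
    and down: "\<forall>j\<le>t. l j = l t + (t - j)" and up: "\<forall>j<2 * m. t \<le> j \<longrightarrow> l j = l t + (j - t)"
    and sq: "\<forall>j<m. level_word (l j) = level_word (l (m + j))"
  shows False
proof -
  define s where "s = l t"
  have down': "l j = s + (t - j)" if "j \<le> t" for j using down that unfolding s_def by blast
  have up': "l j = s + (j - t)" if "t \<le> j" "j < 2 * m" for j using up that unfolding s_def by blast
  consider "t = 0" | "t = 2 * m - 1" "0 < t" | "0 < t" "t < m - 1" | "t = m - 1" "m > 1"
    | "t = m" "t < 2 * m - 1" | "m < t" "t < 2 * m - 1"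
    using assms(1,2) by linarith
  then show False
  proof cases
    case 1
    then have "\<forall>j<m. level_word (s + j) = level_word (s + m + j)"
      using sq by (simp add: up' add.assoc)
    then show False using level_word_square_free[OF assms(1)] by blast
  next
    case 2
    have "level_word (s + j) = level_word (s + m + j)" if "j < m" for j
    proof -
      have "l (m - 1 - j) = s + m + j" "l (m + (m - 1 - j)) = s + j"
        using that 2 by (simp_all add: up' down')
      moreover have "m - 1 - j < m" using that by simp
      ultimately show ?thesis using sq by metis
    qed
    then show False using level_word_square_free[OF assms(1)] by blast
  next
    case 3
    have "l (t - 1) = s + 1" "l (t + 1) = s + 1" using 3 by (simp_all add: up' down')
    moreover have "l (m + (t - 1)) = s + (m - 1)" "l (m + (t + 1)) = s + (m - 1) + 2"
      using 3 by (simp_all add: up' down')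
    moreover have "t - 1 < m" "t + 1 < m" using 3 by auto
    ultimately show False using sq level_word_neq_2 by metis
  next
    case 4
    show False
    \<comment> \<open>The levels at \<open>j\<close> and \<open>m + j\<close> differ by
      \<open>m - 2 - 2 * j\<close>, which is to be 1 or 2. For \<open>m = 2\<close> no
      \<open>j\<close> does this, and \<open>j = 1\<close> with levels \<open>s\<close> and
      \<open>s + 2\<close> serves.\<close>
    proof (cases "m = 2")
      case True
      then have "l 1 = s" "l 3 = s + 2" using 4 by (simp_all add: up' down')
      then show False
        using sq[rule_format, of 1] level_word_neq_2[of s] True by simp
    next
      case False
      have "3 \<le> m" using 4 False by simp
      then have "\<exists>j. m = 2 * j + 3 \<or> m = 2 * j + 4"
        by (intro exI[of _ "(m - 3) div 2"]) linarith
      then obtain j where "m = 2 * j + 3 \<or> m = 2 * j + 4" ..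
      then have j: "j < m" "m - 1 - j = Suc (j + 1) \<or> m - 1 - j = j + 1 + 2" by auto
      have "l j = s + (m - 1 - j)" "l (m + j) = s + (j + 1)"
        using 4 j(1) by (simp_all add: up' down')
      then show False
        using sq j level_word_neq_1[of "s + (j + 1)"] level_word_neq_2[of "s + (j + 1)"]
        by (metis add.assoc add_Suc_right)
    qed
  next
    case 5
    have "\<exists>j. m = 2 * j + 1 \<or> m = 2 * j + 2"
      using assms(1) by (intro exI[of _ "(m - 1) div 2"]) linarith
    then obtain j where "m = 2 * j + 1 \<or> m = 2 * j + 2" ..
    then have j: "j < m" "m - j = Suc j \<or> m - j = j + 2" by auto
    have "l j = s + (m - j)" "l (m + j) = s + j"
      using 5 j(1) by (simp_all add: up' down')
    then show False
      using sq j level_word_neq_1[of "s + j"] level_word_neq_2[of "s + j"]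
      by (metis add.assoc add_Suc_right)
  next
    case 6
    have "l (t - 1) = s + 1" "l (t + 1) = s + 1" using 6 by (simp_all add: up' down')
    moreover have "l (t - 1 - m) = s + (m - 1) + 2" "l (t + 1 - m) = s + (m - 1)"
      using 6 by (simp_all add: up' down')
    moreover have "t - 1 - m < m" "t + 1 - m < m" "m + (t - 1 - m) = t - 1" "m + (t + 1 - m) = t + 1"
      using 6 by auto
    ultimately show False using sq level_word_neq_2 by metis
  qed
qed


text \<open>Without peaks, the first rise is followed by rises only, so it starts at the bottom
  \<open>t\<close>.\<close>

lemma peakless_imp_valley:
  fixes l :: "nat \<Rightarrow> nat"
  assumes "n \<ge> 1"
    and step: "\<And>j. Suc j < n \<Longrightarrow> l (Suc j) = Suc (l j) \<or> l j = Suc (l (Suc j))"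
    and peak: "\<And>j. Suc (Suc j) < n \<Longrightarrow> l (Suc j) = Suc (l j) \<Longrightarrow> l (Suc (Suc j)) = Suc (l (Suc j))"
  obtains t where "t < n" "\<forall>j\<le>t. l j = l t + (t - j)" "\<forall>j<n. t \<le> j \<longrightarrow> l j = l t + (j - t)"
proof -
  \<comment> \<open>The disjunct \<open>Suc t = n\<close> makes the last index the bottom if the
    sequence never rises.\<close>
  define P where "P t \<longleftrightarrow> Suc t = n \<or> l (Suc t) = Suc (l t)" for t
  define t where "t = (LEAST t. P t)"
  have "P (n - 1)" using assms(1) by (simp add: P_def)
  then have Pt: "P t" and le: "t \<le> n - 1" unfolding t_def by (rule LeastI, rule Least_le)
  have t: "t < n" using le assms(1) by simp
  have min: "\<not> P j" if "j < t" for j using that not_less_Least unfolding t_def by blast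
  have "l j = l t + (t - j)" if "j \<le> t" for j
    using that
  proof (induction rule: inc_induct)
    case (step j)
    then have "l j = Suc (l (Suc j))" using min[of j] assms(2)[of j] t by (auto simp: P_def)
    with step show ?case by simp
  qed simp
  moreover have "(Suc j < n \<longrightarrow> l (Suc j) = Suc (l j)) \<and> l j = l t + (j - t)" if "t \<le> j" "j < n" for j
    using that
  proof (induction rule: dec_induct)
    case base
    then show ?case using Pt by (auto simp: P_def)
  next
    case (step j)
    then show ?case using peak[of j] by auto
  qed
  ultimately show ?thesis using that t by blast
qed

section \<open>Colouring forests\<close>

text \<open>A forest is encoded as a symmetric relation each of whose edges is a bridge. Colouring a vertex
  by the letter that the word carries at its distance from the root works because the distances
  along a path first decrease and then increase.\<close>

lemma forest_nonrepetitive_4_colouring: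
  fixes R :: "'a \<Rightarrow> 'a \<Rightarrow> bool"
  assumes sym: "\<And>x y. R x y \<Longrightarrow> R y x"
    and bridge: "\<And>x y. R x y \<Longrightarrow> \<not> (\<lambda>a b. R a b \<and> {a, b} \<noteq> {x, y})\<^sup>*\<^sup>* x y"
  shows "\<exists>c :: 'a \<Rightarrow> nat. (\<forall>x. c x < 4) \<and>
    (\<forall>xs. distinct xs \<and> (\<forall>i. Suc i < length xs \<longrightarrow> R (xs ! i) (xs ! Suc i))
      \<longrightarrow> nonrepetitive (map c xs))"
proof -
  \<comment> \<open>The choice depends only on the set of vertices that reach \<open>x\<close>, so
    it is constant on each component.\<close>
  define root where "root x = (SOME r. R\<^sup>*\<^sup>* r x)" for x
  define d where "d x = (LEAST n. (R ^^ n) (root x) x)" for x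
  have root: "R\<^sup>*\<^sup>* (root x) x" for x
    unfolding root_def by (rule someI[of _ x]) simp
  have d: "(R ^^ d x) (root x) x" for x
    unfolding d_def by (rule LeastI_ex) (use root in \<open>simp add: rtranclp_power\<close>)
  have d_le: "d x \<le> n" if "(R ^^ n) (root x) x" for x n
    unfolding d_def by (rule Least_le) (rule that)
  have root_eq: "root x = root y" if "R x y" for x y
  proof -
    have "R\<^sup>*\<^sup>* r x = R\<^sup>*\<^sup>* r y" for r
      using that sym by (meson rtranclp.rtrancl_into_rtrancl)
    then show ?thesis by (simp add: root_def)
  qed
  have d_Suc: "d y \<le> Suc (d x)" if "R x y" for x y
    using d[of x] that root_eq[OF that] by (intro d_le) auto
  \<comment> \<open>Steps that change the level and stay at level \<open>n\<close> or below. Each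
    vertex of level \<open>n\<close> descends to its root by such steps, so two of them in one
    component are joined without edges inside a level and without vertices of larger level.\<close>
  define Q where "Q n a b \<longleftrightarrow> R a b \<and> d a \<noteq> d b \<and> d a \<le> n \<and> d b \<le> n" for n a b
  have Q_mono: "(Q m)\<^sup>*\<^sup>* a b \<Longrightarrow> m \<le> n \<Longrightarrow> (Q n)\<^sup>*\<^sup>* a b" for m n a b
    by (erule rtranclp_mono[THEN predicate2D, rotated]) (auto simp: Q_def)
  have down: "d x = n \<Longrightarrow> (Q n)\<^sup>*\<^sup>* x (root x)" for x n
  proof (induction n arbitrary: x)
    case 0
    then have "root x = x" using d[of x] by simp
    then show ?case by simp
  next
    case (Suc n)
    then obtain y where y: "(R ^^ n) (root x) y" "R y x" using d[of x] by auto
    have ry: "root y = root x" using root_eq y(2) by blast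
    have "d y = n" using d_le[of n y] y ry d_Suc[OF y(2)] Suc.prems by simp
    then have "(Q n)\<^sup>*\<^sup>* y (root x)" using Suc.IH ry by metis
    then have "(Q (Suc n))\<^sup>*\<^sup>* y (root x)" by (rule Q_mono) simp
    moreover have "Q (Suc n) x y" using y Suc.prems \<open>d y = n\<close> sym by (auto simp: Q_def)
    ultimately show ?case by (rule converse_rtranclp_into_rtranclp[rotated])
  qed
  have Q_sym: "(Q n)\<^sup>*\<^sup>* a b \<Longrightarrow> (Q n)\<^sup>*\<^sup>* b a" for n a b
    by (rule sympD[OF symp_rtranclp]) (auto simp: symp_def Q_def sym)
  have same_level: "(Q n)\<^sup>*\<^sup>* x y" if "d x = n" "d y = n" "root x = root y" for x y n
    using down[OF that(1)] Q_sym[OF down[OF that(2)]] that(3) by (metis rtranclp_trans)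
  \<comment> \<open>An edge inside a level would be bypassed via the root, so it would not be a
    bridge.\<close>
  have d_neq: "d x \<noteq> d y" if "R x y" for x y
  proof
    assume "d x = d y"
    then have "(Q (d x))\<^sup>*\<^sup>* x y" using same_level root_eq that by simp
    then have "(\<lambda>a b. R a b \<and> {a, b} \<noteq> {x, y})\<^sup>*\<^sup>* x y"
      by (rule rtranclp_mono[THEN predicate2D, rotated])
        (use \<open>d x = d y\<close> in \<open>auto simp: Q_def doubleton_eq_iff\<close>)
    with bridge that show False by blast
  qed
  \<comment> \<open>Two parents of \<open>x\<close> are joined without passing \<open>x\<close>;
    appending the edge from \<open>z\<close> to \<open>x\<close> bypasses the edge from
    \<open>y\<close> to \<open>x\<close>.\<close>
  have parent: "y = z" if "R y x" "R z x" "d x = Suc (d y)" "d x = Suc (d z)" for x y z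
  proof (rule ccontr)
    assume "y \<noteq> z"
    have "root y = root z" using root_eq that by metis
    then have "(Q (d y))\<^sup>*\<^sup>* y z" using same_level[of y "d y" z] that by simp
    then have "(\<lambda>a b. R a b \<and> {a, b} \<noteq> {y, x})\<^sup>*\<^sup>* y z"
      by (rule rtranclp_mono[THEN predicate2D, rotated])
        (use that in \<open>auto simp: Q_def doubleton_eq_iff\<close>)
    moreover have "R z x \<and> {z, x} \<noteq> {y, x}"
      using \<open>y \<noteq> z\<close> that by (auto simp: doubleton_eq_iff)
    ultimately have "(\<lambda>a b. R a b \<and> {a, b} \<noteq> {y, x})\<^sup>*\<^sup>* y x"
      by (rule rtranclp.rtrancl_into_rtrancl)
    with bridge that(1) show False by blast
  qed
  have "nonrepetitive (map (level_word \<circ> d) xs)"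
    if dist: "distinct xs" and walk: "\<forall>i. Suc i < length xs \<longrightarrow> R (xs ! i) (xs ! Suc i)" for xs
    unfolding nonrepetitive_def
  proof (intro notI, elim exE conjE)
    fix i m
    assume m: "1 \<le> m" "i + 2 * m \<le> length (map (level_word \<circ> d) xs)"
      and "\<forall>j<m. map (level_word \<circ> d) xs ! (i + j) = map (level_word \<circ> d) xs ! (i + m + j)"
    then have sq: "\<forall>j<m. level_word (d (xs ! (i + j))) = level_word (d (xs ! (i + (m + j))))"
      by (auto simp: add.assoc)
    define l where "l j = d (xs ! (i + j))" for j
    have R: "R (xs ! (i + j)) (xs ! (i + Suc j))" if "Suc j < 2 * m" for j
      using walk that m(2) by auto
    have step: "l (Suc j) = Suc (l j) \<or> l j = Suc (l (Suc j))" if "Suc j < 2 * m" for j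
      using d_Suc[OF R[OF that]] d_Suc[OF sym[OF R[OF that]]] d_neq[OF R[OF that]]
      unfolding l_def by linarith
    \<comment> \<open>On both sides of a peak stands the unique parent of its vertex, against
      distinctness.\<close>
    have peak: "l (Suc (Suc j)) = Suc (l (Suc j))"
      if "Suc (Suc j) < 2 * m" "l (Suc j) = Suc (l j)" for j
    proof (rule ccontr)
      assume "\<not> ?thesis"
      then have "l (Suc j) = Suc (l (Suc (Suc j)))" using step[OF that(1)] by simp
      then have "xs ! (i + j) = xs ! (i + Suc (Suc j))"
        using that R[of j] sym[OF R[of "Suc j"]] unfolding l_def by (intro parent) auto
      then show False using dist that(1) m(2) by (simp add: nth_eq_iff_index_eq)
    qed
    have "1 \<le> 2 * m" using m(1) by simp
    then obtain t where t: "t < 2 * m" "\<forall>j\<le>t. l j = l t + (t - j)"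
      "\<forall>j<2 * m. t \<le> j \<longrightarrow> l j = l t + (j - t)"
      by (rule peakless_imp_valley[of "2 * m" l]) (use step peak in blast)+
    show False
      by (rule level_word_valley[OF m(1) t]) (use sq in \<open>simp add: l_def\<close>)
  qed
  then show ?thesis
    by (intro exI[of _ "level_word \<circ> d"]) (simp add: level_word_less)
qed

section \<open>Faces along an arc\<close>

text \<open>Adding the common limit point \<open>r\<close> keeps \<open>F\<close> and
  \<open>G\<close> connected and makes them meet, so one may cross between faces at any point of a
  shared edge that avoids \<open>K\<close>.\<close>

lemma connected_component_across:
  assumes "connected F" "connected G" "r \<in> closure F" "r \<in> closure G"
    and "F \<inter> K = {}" "G \<inter> K = {}" "r \<notin> K" "a \<in> F" "b \<in> G"
  shows "connected_component (- K) a b"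
proof -
  have "connected (insert r F)" "connected (insert r G)"
    using assms closure_subset by (blast intro: connected_intermediate_closure)+
  then have "connected (insert r F \<union> insert r G)" by (rule connected_Un) blast
  then show ?thesis
    unfolding connected_component_def
    using assms by (intro exI[of _ "insert r F \<union> insert r G"]) auto
qed

lemma connected_component_imp_components_eq:
  assumes "F \<in> components S" "G \<in> components S" "a \<in> F" "b \<in> G" "connected_component S a b"
  shows "F = G"
  by (metis assms components_iff connected_component_eq connected_component_eq_eq mem_Collect_eq)

text \<open>A boundary point itself need not be reachable by a segment, but a point of
  \<open>D\<close> nearest to some \<open>u\<close> in \<open>U\<close> is, by minimality. With
  \<open>u\<close> within \<open>\<epsilon> / 2\<close> of \<open>p\<close>, that point is within
  \<open>\<epsilon>\<close> of \<open>p\<close>.\<close>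

lemma accessible_point_near:
  fixes D :: "'a::euclidean_space set"
  assumes "closed D" "U \<in> components (- D)" "p \<in> D" "p \<in> closure U" "\<epsilon> > 0"
  obtains o' p' where "o' \<in> U" "p' \<in> D" "dist p p' < \<epsilon>" "closed_segment o' p' - {p'} \<subseteq> U"
proof -
  obtain u where u: "u \<in> U" "dist u p < \<epsilon> / 2"
    using assms(4,5) by (meson closure_approachable half_gt_zero)
  obtain p' where p': "p' \<in> D" "\<And>y. y \<in> D \<Longrightarrow> dist u p' \<le> dist u y"
    using distance_attains_inf[OF assms(1), of u] assms(3) by blast
  have "u \<notin> D" using u(1) assms(2) in_components_subset by blast
  then have "u \<noteq> p'" using p' by blast
  have "dist p p' \<le> dist u p + dist u p'" by (metis dist_commute dist_triangle)
  then have "dist p p' < \<epsilon>" using u(2) p'(2)[OF assms(3)] by linarith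
  moreover have "closed_segment u p' - {p'} \<subseteq> U"
  proof (rule components_maximal[OF assms(2)])
    have "closed_segment u p' - {p'} = insert u (open_segment u p')"
      using \<open>u \<noteq> p'\<close> by (auto simp: open_segment_def)
    then have "open_segment u p' \<subseteq> closed_segment u p' - {p'}"
      "closed_segment u p' - {p'} \<subseteq> closure (open_segment u p')"
      using \<open>u \<noteq> p'\<close> by (auto simp: closure_open_segment)
    then show "connected (closed_segment u p' - {p'})"
      by (rule connected_intermediate_closure[rotated])
        (simp add: convex_connected)
    show "closed_segment u p' - {p'} \<subseteq> - D"
    proof
      fix x assume x: "x \<in> closed_segment u p' - {p'}"
      then have "x = u \<or> x \<in> open_segment u p'" by (auto simp: open_segment_def)
      then have "dist u x < dist u p'"
        using \<open>u \<noteq> p'\<close> dist_in_open_segment[of x u p'] by (auto simp: dist_commute)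
      then show "x \<in> - D" using p'(2)[of x] by force
    qed
    show "U \<inter> (closed_segment u p' - {p'}) \<noteq> {}" using u(1) \<open>u \<noteq> p'\<close> by auto
  qed
  ultimately show ?thesis using that u(1) p'(1) by blast
qed

text \<open>If \<open>U\<close> is a third face along the arc, a compact connected set \<open>Z\<close> inside \<open>U\<close> links two interior
  points of the arc. The part of the arc between them together with \<open>Z\<close>, and the rest of the drawing
  together with \<open>Z\<close>, meet exactly in \<open>Z\<close>, and neither separates \<open>F\<close> from \<open>G\<close>; so by Janiszewski's
  theorem their union would not separate \<open>F\<close> from \<open>G\<close> either.\<close>

lemma no_three_faces_along_arc:
  fixes D :: "complex set"
  assumes e: "arc e" and D: "compact D" and De: "D \<inter> path_image e = {pathstart e, pathfinish e}"
    and F: "F \<in> components (- (D \<union> path_image e))" "path_image e \<subseteq> closure F"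
    and G: "G \<in> components (- (D \<union> path_image e))" "path_image e \<subseteq> closure G"
    and U: "U \<in> components (- (D \<union> path_image e))" "path_image e \<subseteq> closure U"
    and ne: "F \<noteq> G" "U \<noteq> F" "U \<noteq> G"
  shows False
proof -
  have inj: "inj_on e {0..1}" and cont: "continuous_on {0..1} e"
    using e by (auto simp: arc_def path_def)
  have e_eq: "e x = e y \<longleftrightarrow> x = y" if "x \<in> {0..1}" "y \<in> {0..1}" for x y
    using inj that by (auto simp: inj_on_def)
  have eD: "e x \<in> D \<longleftrightarrow> x = 0 \<or> x = 1" if "x \<in> {0..1}" for x
  proof -
    have "e x \<in> D \<longleftrightarrow> e x \<in> {e 0, e 1}"
      using De that unfolding path_image_def pathstart_def pathfinish_def by blast
    also have "\<dots> \<longleftrightarrow> x = 0 \<or> x = 1" using e_eq[OF that, of 0] e_eq[OF that, of 1] by simp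
    finally show ?thesis .
  qed
  let ?D = "D \<union> path_image e"
  have clD: "closed ?D"
    using D e by (simp add: closed_Un compact_imp_closed closed_arc_image)
  have ePI: "e x \<in> path_image e" if "x \<in> {0..1}" for x
    using that by (simp add: path_image_def)
  \<comment> \<open>A ball around \<open>e y\<close> that misses \<open>D\<close> ensures that the
    reachable point near \<open>e y\<close> is an interior point of the arc.\<close>
  have access: "\<exists>x w. 0 < x \<and> x < 1 \<and> dist (e y) (e x) < \<epsilon> \<and> w \<in> U \<and> closed_segment w (e x) - {e x} \<subseteq> U"
    if y: "0 < y" "y < 1" and "\<epsilon> > 0" for y \<epsilon>
  proof -
    have "e y \<notin> D" using eD[of y] y by auto
    then obtain \<delta> where \<delta>: "\<delta> > 0" "ball (e y) \<delta> \<subseteq> - D"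
      using compact_imp_closed[OF D] by (meson ComplI open_Compl openE)
    obtain w p where w: "w \<in> U" "p \<in> ?D" "dist (e y) p < min \<delta> \<epsilon>" "closed_segment w p - {p} \<subseteq> U"
      by (rule accessible_point_near[OF clD U(1), of "e y" "min \<delta> \<epsilon>"])
        (use ePI[of y] y U(2) \<delta>(1) \<open>\<epsilon> > 0\<close> in auto)
    then have "p \<notin> D" using \<delta>(2) by auto
    with w(2) obtain x where x: "x \<in> {0..1}" "p = e x" by (auto simp: path_image_def)
    with \<open>p \<notin> D\<close> have "0 < x" "x < 1" using eD[of x] by force+
    with w x show ?thesis by auto
  qed
  have "\<exists>s t Z. 0 < s \<and> s < t \<and> t < 1 \<and> compact Z \<and> connected Z \<and> e s \<in> Z \<and> e t \<in> Z \<and>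
      Z \<subseteq> U \<union> {e s, e t}"
  proof -
    \<comment> \<open>Half the distance of two interior points, so that the reachable points near
      them are distinct.\<close>
    define \<epsilon> where "\<epsilon> = dist (e (1/3)) (e (2/3)) / 2"
    have "\<epsilon> > 0" using e_eq[of "1/3" "2/3"] by (simp add: \<epsilon>_def)
    obtain x w where x: "0 < x" "x < 1" "dist (e (1/3)) (e x) < \<epsilon>" "w \<in> U"
      "closed_segment w (e x) - {e x} \<subseteq> U"
      using access[of "1/3" \<epsilon>] \<open>\<epsilon> > 0\<close> by auto
    obtain y v where y: "0 < y" "y < 1" "dist (e (2/3)) (e y) < \<epsilon>" "v \<in> U"
      "closed_segment v (e y) - {e y} \<subseteq> U"
      using access[of "2/3" \<epsilon>] \<open>\<epsilon> > 0\<close> by auto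
    have "x \<noteq> y"
    proof
      assume "x = y"
      then have "dist (e (1/3)) (e (2/3)) < 2 * \<epsilon>"
        using x(3) y(3) dist_triangle_half_l[of "e (1/3)" "e x" "2 * \<epsilon>" "e (2/3)"]
        by (simp add: dist_commute)
      then show False by (simp add: \<epsilon>_def)
    qed
    have "open U" using open_components clD U(1) by (metis open_Compl)
    then have "path_connected U"
      using U(1) in_components_connected connected_open_path_connected by blast
    then obtain g where g: "path g" "path_image g \<subseteq> U" "pathstart g = w" "pathfinish g = v"
      using x(4) y(4) by (meson path_connected_def)
    define Z where "Z = closed_segment w (e x) \<union> path_image g \<union> closed_segment v (e y)"
    have "w \<in> path_image g" "v \<in> path_image g"
      using g by (metis pathstart_in_path_image, metis pathfinish_in_path_image)
    then have "connected Z" unfolding Z_def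
      using g(1) by (intro connected_Un connected_path_image) auto
    moreover have "compact Z" unfolding Z_def using g(1) by (intro compact_Un compact_path_image) auto
    moreover have "e x \<in> Z" "e y \<in> Z" "Z \<subseteq> U \<union> {e x, e y}"
      using x(5) y(5) g(2) by (auto simp: Z_def)
    ultimately show ?thesis
      using x(1,2) y(1,2) \<open>x \<noteq> y\<close> insert_commute[of "e x" "e y" "{}"]
      by (cases x y rule: linorder_cases) (metis, blast, metis)
  qed
  then obtain s t Z where st: "0 < s" "s < t" "t < 1"
    and Z: "compact Z" "connected Z" "e s \<in> Z" "e t \<in> Z" "Z \<subseteq> U \<union> {e s, e t}"
    by blast
  define A B where "A = e ` ({0..s} \<union> {t..1})" and "B = e ` {s..t}"
  have AB: "A \<union> B = path_image e"
    unfolding A_def B_def path_image_def image_Un[symmetric] using st by (intro arg_cong[of _ _ "image e"]) auto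
  have "compact A" "compact B"
    unfolding A_def B_def using st
    by (auto intro!: compact_continuous_image compact_Un continuous_on_subset[OF cont])
  have UD: "U \<inter> ?D = {}" and FD: "F \<inter> ?D = {}" and GD: "G \<inter> ?D = {}"
    using F(1) G(1) U(1) in_components_subset by blast+
  have "F \<inter> U = {}" "G \<inter> U = {}" using components_nonoverlap F(1) G(1) U(1) ne by metis+
  have "e s \<in> path_image e" "e t \<in> path_image e" using ePI st by auto
  have disj: "H \<inter> (D \<union> A \<union> Z) = {}" "H \<inter> (B \<union> Z) = {}" if "H \<inter> ?D = {}" "H \<inter> U = {}" for H
    using that Z(5) AB \<open>e s \<in> path_image e\<close> \<open>e t \<in> path_image e\<close> by blast+
  obtain a b where ab: "a \<in> F" "b \<in> G" using F(1) G(1) in_components_nonempty by blast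
  have con: "connected F" "connected G" using F(1) G(1) in_components_connected by blast+
  have not_Z: "e x \<notin> Z" if "x \<in> {0..1}" "x \<noteq> s" "x \<noteq> t" for x
    using that Z(5) UD ePI[of x] e_eq[of x s] e_eq[of x t] st by auto
  have "connected_component (- (D \<union> A \<union> Z)) a b"
  proof (rule connected_component_across[OF con])
    let ?r = "(s + t) / 2"
    have r: "?r \<in> {0..1}" "?r \<noteq> s" "?r \<noteq> t" "?r \<noteq> 0" "?r \<noteq> 1" "?r \<notin> {0..s} \<union> {t..1}"
      using st by auto
    then show "e ?r \<in> closure F" "e ?r \<in> closure G" using F(2) G(2) ePI by blast+
    have "e ?r \<notin> A"
      unfolding A_def using r st by (subst inj_on_image_mem_iff[OF inj]) auto
    then show "e ?r \<notin> D \<union> A \<union> Z" using not_Z eD r by blast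
  qed (use disj FD GD \<open>F \<inter> U = {}\<close> \<open>G \<inter> U = {}\<close> ab in auto)
  moreover have "connected_component (- (B \<union> Z)) a b"
  proof (rule connected_component_across[OF con])
    let ?r = "s / 2"
    have r: "?r \<in> {0..1}" "?r \<noteq> s" "?r \<noteq> t" "?r \<notin> {s..t}" using st by auto
    then show "e ?r \<in> closure F" "e ?r \<in> closure G" using F(2) G(2) ePI by blast+
    have "e ?r \<notin> B"
      unfolding B_def using r st by (subst inj_on_image_mem_iff[OF inj]) auto
    then show "e ?r \<notin> B \<union> Z" using not_Z r by blast
  qed (use disj FD GD \<open>F \<inter> U = {}\<close> \<open>G \<inter> U = {}\<close> ab in auto)
  moreover have "(D \<union> A \<union> Z) \<inter> (B \<union> Z) = Z"
  proof -
    have "D \<inter> B = {}" unfolding B_def using eD st by force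
    moreover have "A \<inter> B = e ` (({0..s} \<union> {t..1}) \<inter> {s..t})"
      unfolding A_def B_def using st by (intro inj_on_image_Int[OF inj, symmetric]) auto
    then have "A \<inter> B \<subseteq> Z" using Z(3,4) by auto
    ultimately show ?thesis by blast
  qed
  ultimately have "connected_component (- ((D \<union> A \<union> Z) \<union> (B \<union> Z))) a b"
    using D Z(1,2) \<open>compact A\<close> \<open>compact B\<close>
    by (intro Janiszewski[of "D \<union> A \<union> Z" "B \<union> Z"] compact_Un compact_imp_closed) simp_all
  then have "connected_component (- ?D) a b"
    by (rule connected_component_of_subset) (use AB in auto)
  then show False using connected_component_imp_components_eq[OF F(1) G(1) ab] ne(1) by simp
qed

text \<open>The radial retraction onto the ball maps \<open>closure U\<close> onto this set, since
  points outside land on the sphere, which lies in \<open>U\<close>. This truncates the closure of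
  the outer face to the compact set that Janiszewski's theorem asks for.\<close>

lemma connected_closure_Int_cball:
  fixes U :: "'a::real_normed_vector set"
  assumes "connected U" "- ball 0 R \<subseteq> U" "R > 0"
  shows "connected (closure U \<inter> cball 0 R)"
proof -
  define p where "p x = (R / max R (norm x)) *\<^sub>R x" for x :: 'a
  have id: "p x = x" if "x \<in> cball 0 R" for x using that assms(3) by (simp add: p_def max_def)
  have "p ` closure U = closure U \<inter> cball 0 R"
  proof (intro subset_antisym subsetI)
    fix y assume "y \<in> p ` closure U"
    then obtain x where x: "x \<in> closure U" "y = p x" by blast
    show "y \<in> closure U \<inter> cball 0 R"
    proof (cases "x \<in> cball 0 R")
      case True
      then show ?thesis using x id by simp
    next
      case False
      then have "norm y = R" using assms(3) by (auto simp: x(2) p_def max_def)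
      then show ?thesis using assms(2) closure_subset by fastforce
    qed
  next
    fix y assume "y \<in> closure U \<inter> cball 0 R"
    then show "y \<in> p ` closure U" using id by (metis IntD1 IntD2 image_eqI)
  qed
  moreover have "continuous_on (closure U) p"
    unfolding p_def using assms(3) by (intro continuous_intros) (auto simp: max_def)
  ultimately show ?thesis
    using assms(1) by (metis connected_imp_connected_closure connected_continuous_image)
qed

text \<open>The rest of the drawing together with the closure of \<open>U\<close> does not separate \<open>F\<close> from \<open>G\<close>, and it
  meets the union of the arc and the closure of \<open>U\<close> in the (connected) closure of \<open>U\<close>. So
  Janiszewski's theorem forces the latter set to separate the two faces.\<close>

lemma arc_with_outer_face_separates:
  fixes D :: "complex set"
  assumes e: "arc e" and D: "compact D" and De: "D \<inter> path_image e = {pathstart e, pathfinish e}"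
    and F: "F \<in> components (- (D \<union> path_image e))" "path_image e \<subseteq> closure F"
    and G: "G \<in> components (- (D \<union> path_image e))" "path_image e \<subseteq> closure G"
    and U: "U \<in> components (- (D \<union> path_image e))" "\<not> bounded U"
      "pathstart e \<in> closure U" "pathfinish e \<in> closure U"
    and ne: "F \<noteq> G" "U \<noteq> F" "U \<noteq> G" and ab: "a \<in> F" "b \<in> G"
  shows "\<not> connected_component (- (path_image e \<union> closure U)) a b"
proof
  assume cc: "connected_component (- (path_image e \<union> closure U)) a b"
  let ?D = "D \<union> path_image e"
  \<comment> \<open>If the whole arc lay in \<open>closure U\<close>, three faces would meet along
    it. The point \<open>r\<close> is interior to the arc because both ends lie in
    \<open>closure U\<close>.\<close>
  obtain r where r: "r \<in> path_image e" "r \<notin> closure U"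
    using no_three_faces_along_arc[OF e D De F G U(1) _ ne] by blast
  then have "r \<notin> D" using De U(3,4) by (metis IntI empty_iff insert_iff)
  have cD: "compact ?D" using D e by (simp add: compact_Un compact_arc_image)
  then obtain R where R: "R > 0" "?D \<subseteq> ball 0 R"
    using bounded_subset_ballD[OF compact_imp_bounded] by blast
  have "- ball 0 R \<subseteq> U"
  proof (rule components_maximal[OF U(1)])
    show "connected (- ball 0 R :: complex set)"
      by (rule connected_complement_bounded_convex) auto
    show "U \<inter> - ball 0 R \<noteq> {}" using U(2) bounded_subset[OF bounded_ball, of U 0 R] by blast
  qed (use R(2) in auto)
  define X where "X = closure U \<inter> cball 0 R"
  have "connected X" unfolding X_def
    by (rule connected_closure_Int_cball[OF in_components_connected[OF U(1)] \<open>- ball 0 R \<subseteq> U\<close> R(1)])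
  have "compact X" unfolding X_def by (simp add: closed_Int_compact)
  have op: "open F" "open G"
    using F(1) G(1) open_components cD by (metis compact_imp_closed open_Compl)+
  have "F \<inter> U = {}" "G \<inter> U = {}" using components_nonoverlap F(1) G(1) U(1) ne by metis+
  then have FU: "F \<inter> closure U = {}" "G \<inter> closure U = {}"
    using op open_Int_closure_eq_empty by blast+
  have "connected_component (- (D \<union> X)) a b"
  proof (rule connected_component_across[OF _ _ _ _ _ _ _ ab])
    show "r \<in> closure F" "r \<in> closure G" using r F(2) G(2) by auto
    show "r \<notin> D \<union> X" using r \<open>r \<notin> D\<close> by (auto simp: X_def)
    show "F \<inter> (D \<union> X) = {}" "G \<inter> (D \<union> X) = {}"
      using FU in_components_subset[OF F(1)] in_components_subset[OF G(1)] by (auto simp: X_def)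
  qed (use F(1) G(1) in_components_connected in auto)
  moreover have "(D \<union> X) \<inter> (path_image e \<union> closure U) = X"
  proof -
    have "D \<inter> path_image e \<subseteq> closure U" using De U(3,4) by simp
    moreover have "D \<subseteq> cball 0 R" using R(2) by (auto simp: subset_iff intro: less_imp_le)
    ultimately show ?thesis unfolding X_def by blast
  qed
  ultimately have "connected_component (- ((D \<union> X) \<union> (path_image e \<union> closure U))) a b"
    using \<open>connected X\<close> \<open>compact X\<close> D e cc
    by (intro Janiszewski[of "D \<union> X" "path_image e \<union> closure U"] compact_Un closed_Un closed_arc_image)
      simp_all
  then have "connected_component (- ?D) a b"
    by (rule connected_component_of_subset) auto
  then show False using connected_component_imp_components_eq[OF F(1) G(1) ab] ne(1) by simp
qed

section \<open>The bounded faces of an outerplanar map\<close>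

lemma plane_graph_remove_edge:
  assumes "plane_graph V E" "e \<in> E"
  defines "D \<equiv> V \<union> \<Union> (path_image ` (E - {e}))"
  shows "arc e" "compact D" "drawing V E = D \<union> path_image e"
    "D \<inter> path_image e = {pathstart e, pathfinish e}"
proof -
  show "arc e" using assms(1,2) by (simp add: plane_graph_def)
  show "compact D" unfolding D_def using assms(1)
    by (intro compact_Un compact_UN)
      (auto simp: plane_graph_def intro: finite_imp_compact compact_arc_image)
  show "drawing V E = D \<union> path_image e" using assms(2) by (auto simp: drawing_def D_def)
  have "path_image e' \<inter> path_image e \<subseteq> {pathstart e, pathfinish e}" if "e' \<in> E - {e}" for e'
    using assms(1,2) that unfolding plane_graph_def by blast
  moreover have "V \<inter> path_image e = {pathstart e, pathfinish e}"
    using assms(1,2) unfolding plane_graph_def by auto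
  ultimately show "D \<inter> path_image e = {pathstart e, pathfinish e}" unfolding D_def by blast
qed

lemma compact_drawing:
  assumes "plane_graph V E"
  shows "compact (drawing V E)"
  unfolding drawing_def using assms
  by (intro compact_Un compact_UN)
    (auto simp: plane_graph_def intro: finite_imp_compact compact_arc_image)

lemma unbounded_face_unique:
  assumes "plane_graph V E" "F \<in> faces V E" "\<not> bounded F" "G \<in> faces V E" "\<not> bounded G"
  shows "F = G"
  using assms compact_imp_bounded[OF compact_drawing[OF assms(1)]]
  by (intro cobounded_unique_unbounded_components[of "- drawing V E"]) (auto simp: faces_def)

text \<open>The conjunct \<open>F \<noteq> G\<close> excludes loops: a loop is no bridge, as every
  vertex reaches itself by the empty chain.\<close>

definition inner_adjacent ::
  "complex set \<Rightarrow> (real \<Rightarrow> complex) set \<Rightarrow> complex set \<Rightarrow> complex set \<Rightarrow> bool" where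
  "inner_adjacent V E F G \<longleftrightarrow> F \<in> faces V E \<and> G \<in> faces V E \<and> bounded F \<and> bounded G \<and> F \<noteq> G \<and>
     faces_share_edge E F G"

lemma inner_adjacent_sym: "inner_adjacent V E F G \<Longrightarrow> inner_adjacent V E G F"
  by (auto simp: inner_adjacent_def faces_share_edge_def)

lemma frontier_subset_closure: "frontier S \<subseteq> closure S"
  by (simp add: frontier_def)

text \<open>The arc \<open>e\<close> shared by \<open>F\<close> and \<open>G\<close> separates them
  together with \<open>closure U\<close>. Any other adjacent pair can be joined across a point off
  this set, so a chain avoiding the pair would link \<open>F\<close> to \<open>G\<close> in its
  complement.\<close>

lemma inner_adjacent_bridge:
  assumes om: "outerplanar_map V E" and adj: "inner_adjacent V E F G"
  shows "\<not> (\<lambda>A B. inner_adjacent V E A B \<and> {A, B} \<noteq> {F, G})\<^sup>*\<^sup>* F G"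
proof
  assume chain: "(\<lambda>A B. inner_adjacent V E A B \<and> {A, B} \<noteq> {F, G})\<^sup>*\<^sup>* F G"
  have pg: "plane_graph V E" using om by (simp add: outerplanar_map_def)
  have F: "F \<in> faces V E" "bounded F" and G: "G \<in> faces V E" "bounded G" and "F \<noteq> G"
    using adj by (auto simp: inner_adjacent_def)
  obtain e where e: "e \<in> E" "path_image e \<subseteq> closure F" "path_image e \<subseteq> closure G"
    using adj frontier_subset_closure unfolding inner_adjacent_def faces_share_edge_def by blast
  note split = plane_graph_remove_edge[OF pg]
  have third: "\<not> path_image e' \<subseteq> closure C"
    if "e' \<in> E" "A \<in> faces V E" "B \<in> faces V E" "C \<in> faces V E" "A \<noteq> B" "C \<noteq> A" "C \<noteq> B"
      "path_image e' \<subseteq> closure A" "path_image e' \<subseteq> closure B" for e' A B C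
    using no_three_faces_along_arc[OF split(1,2,4)[OF that(1)], folded split(3)[OF that(1)]] that
    unfolding faces_def by metis
  have "pathstart e \<in> V" "pathfinish e \<in> V"
    using pg e(1) by (auto simp: plane_graph_def)
  then obtain U where U: "U \<in> faces V E" "\<not> bounded U" "pathstart e \<in> closure U"
    "pathfinish e \<in> closure U"
    using om unbounded_face_unique[OF pg] frontier_subset_closure
    unfolding outerplanar_map_def by (metis subsetD)
  have Ub: "U \<noteq> A" if "bounded A" for A using U(2) that by blast
  have sep: "\<not> connected_component (- (path_image e \<union> closure U)) a b" if "a \<in> F" "b \<in> G" for a b
    using arc_with_outer_face_separates[OF split(1,2,4)[OF e(1)], folded split(3)[OF e(1)],
        of F G U a b] F G U e \<open>F \<noteq> G\<close> Ub that unfolding faces_def by blast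
  have face: "connected A" "A \<inter> (path_image e \<union> closure U) = {}"
    if "A \<in> faces V E" "bounded A" for A
  proof -
    show "connected A" using that(1) in_components_connected unfolding faces_def by blast
    have "open A"
      using that(1) open_components compact_drawing[OF pg] unfolding faces_def
      by (metis compact_imp_closed open_Compl)
    moreover have "A \<inter> U = {}"
      using components_nonoverlap[of A _ U] that U(1) Ub unfolding faces_def by metis
    ultimately have "A \<inter> closure U = {}" using open_Int_closure_eq_empty by blast
    moreover have "A \<inter> drawing V E = {}"
      using that(1) in_components_subset unfolding faces_def by blast
    ultimately show "A \<inter> (path_image e \<union> closure U) = {}" using split(3)[OF e(1)] by blast
  qed
  have link: "connected_component (- (path_image e \<union> closure U)) a b"
    if AB: "inner_adjacent V E A B" "{A, B} \<noteq> {F, G}" and ab: "a \<in> A" "b \<in> B" for A B a b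
  proof -
    have A: "A \<in> faces V E" "bounded A" and B: "B \<in> faces V E" "bounded B" and "A \<noteq> B"
      using AB by (auto simp: inner_adjacent_def)
    obtain e' where e': "e' \<in> E" "path_image e' \<subseteq> closure A" "path_image e' \<subseteq> closure B"
      using AB frontier_subset_closure unfolding inner_adjacent_def faces_share_edge_def by blast
    \<comment> \<open>Otherwise \<open>A\<close> and \<open>B\<close> lie along \<open>e\<close>; as
      no face other than \<open>F\<close> and \<open>G\<close> does, they would be the excluded
      pair.\<close>
    have "e' \<noteq> e"
    proof
      assume "e' = e"
      have "C = F \<or> C = G" if "C \<in> {A, B}" for C
        using third[OF e(1) F(1) G(1) _ \<open>F \<noteq> G\<close> _ _ e(2,3), of C] that A B e' \<open>e' = e\<close> by blast
      then show False using AB(2) \<open>A \<noteq> B\<close> by blast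
    qed
    \<comment> \<open>By \<open>third\<close>, some point of \<open>e'\<close> is off
      \<open>closure U\<close>. It is not on \<open>e\<close> either: distinct edges meet only in
      ends of \<open>e\<close>, which lie in \<open>closure U\<close>.\<close>
    obtain r where r: "r \<in> path_image e'" "r \<notin> closure U"
      using third[OF e'(1) A(1) B(1) U(1) \<open>A \<noteq> B\<close> Ub[OF A(2)] Ub[OF B(2)] e'(2,3)] by blast
    have "r \<notin> path_image e"
    proof
      assume "r \<in> path_image e"
      moreover have "r \<in> V \<union> \<Union> (path_image ` (E - {e}))" using r(1) e'(1) \<open>e' \<noteq> e\<close> by blast
      ultimately have "r \<in> {pathstart e, pathfinish e}" using split(4)[OF e(1)] by blast
      then show False using r(2) U(3,4) by blast
    qed
    then show ?thesis
      using r e' face A B ab by (intro connected_component_across[of A B r]) auto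
  qed
  obtain a where a: "a \<in> F" using F(1) in_components_nonempty unfolding faces_def by blast
  have "\<forall>b\<in>G. connected_component (- (path_image e \<union> closure U)) a b"
    using chain
  proof (induction rule: rtranclp_induct)
    case base
    show ?case using face[OF F] a unfolding connected_component_def by blast
  next
    case (step A B)
    then have "A \<in> faces V E" by (simp add: inner_adjacent_def)
    then obtain x where "x \<in> A" using in_components_nonempty unfolding faces_def by blast
    with step show ?case using link connected_component_trans by blast
  qed
  moreover obtain b where "b \<in> G" using G(1) in_components_nonempty unfolding faces_def by blast
  ultimately show False using sep a by blast
qed

theorem theorem1:
  fixes V :: "complex set" and E :: "(real \<Rightarrow> complex) set"
  assumes "outerplanar_map V E"
  shows "\<exists>c :: complex set \<Rightarrow> nat.
           (\<forall>F\<in>faces V E. c F < 5) \<and> nonrep_face_colouring V E c"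
proof -
  have pg: "plane_graph V E" using assms by (simp add: outerplanar_map_def)
  obtain c :: "complex set \<Rightarrow> nat" where c: "\<And>F. c F < 4"
    and nr: "\<And>Fs. distinct Fs \<Longrightarrow>
      \<forall>i. Suc i < length Fs \<longrightarrow> inner_adjacent V E (Fs ! i) (Fs ! Suc i) \<Longrightarrow>
      nonrepetitive (map c Fs)"
    using forest_nonrepetitive_4_colouring[of "inner_adjacent V E",
        OF inner_adjacent_sym inner_adjacent_bridge[OF assms]] by blast
  define c' where "c' F = (if bounded F then c F else 4)" for F
  have c'_4: "c' F = 4 \<longleftrightarrow> \<not> bounded F" for F using c[of F] by (simp add: c'_def)
  have "nonrepetitive (map c' Fs)"
    if Fs: "set Fs \<subseteq> faces V E" "distinct Fs"
      and walk: "\<forall>i. Suc i < length Fs \<longrightarrow> faces_share_edge E (Fs ! i) (Fs ! Suc i)" for Fs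
    unfolding nonrepetitive_def
  proof (intro notI, elim exE conjE)
    fix i m
    assume m: "1 \<le> m" "i + 2 * m \<le> length (map c' Fs)"
      and "\<forall>j<m. map c' Fs ! (i + j) = map c' Fs ! (i + m + j)"
    then have sq: "c' (Fs ! (i + j)) = c' (Fs ! (i + m + j))" if "j < m" for j
      using that by auto
    have inF: "Fs ! k \<in> faces V E" if "k < i + 2 * m" for k using that Fs(1) m(2) by auto
    \<comment> \<open>Colour 4 marks unbounded faces only, so an unbounded face would be matched
      with an unbounded one, hence with itself, against distinctness.\<close>
    have "bounded (Fs ! (i + j)) \<and> bounded (Fs ! (i + m + j))" if "j < m" for j
    proof (rule ccontr)
      assume "\<not> ?thesis"
      then have "\<not> bounded (Fs ! (i + j))" "\<not> bounded (Fs ! (i + m + j))"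
        using c'_4 sq[OF that] by metis+
      then have "Fs ! (i + j) = Fs ! (i + m + j)"
        using unbounded_face_unique[OF pg] inF that by auto
      then show False using Fs(2) m that by (simp add: nth_eq_iff_index_eq)
    qed
    note bounded_halves = this
    have bd: "bounded (Fs ! (i + j))" if "j < 2 * m" for j
      using bounded_halves[of j] bounded_halves[of "j - m"] that by (cases "j < m") auto
    \<comment> \<open>Only the window of the repetition goes to the forest colouring, as the outer
      face may occur elsewhere in \<open>Fs\<close>.\<close>
    define Gs where "Gs = take (2 * m) (drop i Fs)"
    have len: "length Gs = 2 * m" using m(2) by (simp add: Gs_def)
    have nth: "Gs ! j = Fs ! (i + j)" if "j < 2 * m" for j using that m(2) by (simp add: Gs_def)
    have "distinct Gs" using Fs(2) by (simp add: Gs_def)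
    moreover have "inner_adjacent V E (Gs ! j) (Gs ! Suc j)" if "Suc j < length Gs" for j
    proof -
      have "Fs ! (i + j) \<noteq> Fs ! (i + Suc j)"
        using Fs(2) that len m(2) by (simp add: nth_eq_iff_index_eq)
      then show ?thesis
        unfolding inner_adjacent_def
        using that len bd[of j] bd[of "Suc j"] inF[of "i + j"] inF[of "i + Suc j"] walk m(2)
        by (simp add: nth)
    qed
    ultimately have "nonrepetitive (map c Gs)" using nr by blast
    moreover have "map c Gs ! (0 + j) = map c Gs ! (0 + m + j)" if "j < m" for j
      using sq[OF that] bd[of j] bd[of "m + j"] that len by (simp add: nth c'_def add.assoc)
    ultimately show False
      unfolding nonrepetitive_def using m(1) len by (metis add_0 length_map order_refl)
  qed
  then have "nonrep_face_colouring V E c'" by (simp add: nonrep_face_colouring_def)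
  moreover have "c' F < 5" for F using c[of F] by (simp add: c'_def)
  ultimately show ?thesis by blast
qed

end
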